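(* For each $n\in\mathbb{N}$, the class of languages accepted by register set automata with at most $n$ registers is closed under union, and is not closed under intersection and not closed under complement.
   Context: $\mathbb{N}$ denotes the positive integers. Fix a finite nonempty alphabet $\Sigma$ and an infinite data domain $\mathbb{D}$. A register set automaton (RsA) is a tuple $(Q,R,\Delta,I,F)$ with $Q$ finite states, $R$ finite registers, $I,F\subseteq Q$, and transitions $q\xrightarrow{a\mid G^{\in},G^{\notin},up}s$ with $a\in\Sigma$, $G^{\in},G^{\notin}\subseteq R$ disjoint, $up\colon R\to 2^{R\cup\{\mathit{in}\}}$. Configurations are $(q,f)$ with $f\colon R\to 2^{\mathbb{D}}$; initial ones have $q\in I$ and all registers empty. A step over $(a,d)$ is possible iff $d\in f(r)$ for all $r\in G^{\in}$ and $d\notin f(r)$ for all $r\in G^{\notin}$; afterwards each register $r$ holds $\bigcup\{f(r')\mid r'\in R\cap up(r)\}$, plus $d$ if $\mathit{in}\in up(r)$. $L(\mathcal{A})\subseteq(\Sigma\times\mathbb{D})^*$ is the set of words with a run from an initial configuration ending in $F$. Complement is taken with respect to $(\Sigma\times\mathbb{D})^*$. *)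

theory Defs
  imports Main "HOL-Library.FuncSet"
begin

text \<open>The alphabet and the data domain are the types \<open>'a\<close> and \<open>'d\<close>; a data word is a list of
  type \<open>('a \<times> 'd) list\<close>. States and registers are finite subsets of the types \<open>'q\<close> and \<open>'r\<close>.\<close>

datatype 'r source = In | Reg 'r

text \<open>A transition is a tuple \<open>(q, a, Gin, Gout, up, s)\<close>.\<close>

type_synonym ('q, 'r, 'a) transition =
  "'q \<times> 'a \<times> 'r set \<times> 'r set \<times> ('r \<Rightarrow> 'r source set) \<times> 'q"

record ('q, 'r, 'a) rsa =
  states :: "'q set"
  registers :: "'r set"
  transitions :: "('q, 'r, 'a) transition set"
  initial :: "'q set"
  final :: "'q set"

text \<open>The functions on registers, both the updates and the register valuations, are extensional
  functions on \<^term>\<open>registers A\<close>, so they are determined by their values on the actual registers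
  (in particular, there are only finitely many transitions if \<open>'a\<close> is finite).\<close>

definition wf_rsa :: "('q, 'r, 'a) rsa \<Rightarrow> bool" where
  "wf_rsa A \<longleftrightarrow>
     finite (states A) \<and> finite (registers A) \<and>
     initial A \<subseteq> states A \<and> final A \<subseteq> states A \<and>
     (\<forall>(q, a, Gin, Gout, up, s) \<in> transitions A.
        q \<in> states A \<and> s \<in> states A \<and>
        Gin \<subseteq> registers A \<and> Gout \<subseteq> registers A \<and> Gin \<inter> Gout = {} \<and>
        up \<in> registers A \<rightarrow>\<^sub>E Pow (insert In (Reg ` registers A)))"

type_synonym ('q, 'r, 'd) config = "'q \<times> ('r \<Rightarrow> 'd set)"

definition initial_config :: "('q, 'r, 'a) rsa \<Rightarrow> ('q, 'r, 'd) config \<Rightarrow> bool" where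
  "initial_config A c \<longleftrightarrow> fst c \<in> initial A \<and> snd c = (\<lambda>r\<in>registers A. {})"

inductive step ::
  "('q, 'r, 'a) rsa \<Rightarrow> ('q, 'r, 'd) config \<Rightarrow> 'a \<times> 'd \<Rightarrow> ('q, 'r, 'd) config \<Rightarrow> bool"
  for A :: "('q, 'r, 'a) rsa" where
  "\<lbrakk> (q, a, Gin, Gout, up, s) \<in> transitions A;
     \<forall>r\<in>Gin. d \<in> f r;
     \<forall>r\<in>Gout. d \<notin> f r;
     f' = (\<lambda>r\<in>registers A.
             (\<Union>r' \<in> {r' \<in> registers A. Reg r' \<in> up r}. f r') \<union> (if In \<in> up r then {d} else {})) \<rbrakk>
   \<Longrightarrow> step A (q, f) (a, d) (s, f')"

inductive run ::
  "('q, 'r, 'a) rsa \<Rightarrow> ('q, 'r, 'd) config \<Rightarrow> ('a \<times> 'd) list \<Rightarrow> ('q, 'r, 'd) config \<Rightarrow> bool"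
  for A :: "('q, 'r, 'a) rsa" where
  run_Nil: "run A c [] c"
| run_Cons: "step A c x c' \<Longrightarrow> run A c' w c'' \<Longrightarrow> run A c (x # w) c''"

definition rsa_language :: "('q, 'r, 'a) rsa \<Rightarrow> ('a \<times> 'd) list set" where
  "rsa_language A = {w. \<exists>c c'. initial_config A c \<and> run A c w c' \<and> fst c' \<in> final A}"

text \<open>The class of languages of automata with at most \<open>n\<close> registers. As the sets of states and
  registers are finite, taking their elements from \<^typ>\<open>nat\<close> is no loss of generality.\<close>

definition rsa_languages :: "nat \<Rightarrow> ('a \<times> 'd) list set set" where
  "rsa_languages n =
     {rsa_language A | A :: (nat, nat, 'a) rsa. wf_rsa A \<and> card (registers A) \<le> n}"

end

theory Submission
  imports Defs "HOL-Combinatorics.Transposition"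
begin

text \<open>For the union, rename the registers of both automata into a common set of \<open>n\<close> registers,
  make the state sets disjoint, and let nondeterminism choose the automaton.

  For the intersection, put \<open>m = n + 1\<close> and consider the language of all words in which, for each
  residue class modulo \<open>m\<close>, the data at the positions in that class are pairwise distinct. It is the
  intersection of the language imposing this condition on the first \<open>n\<close> classes and the one
  imposing it on the last class, which take \<open>n\<close> registers and one register. No automaton with \<open>n\<close>
  registers accepts it: take data \<open>e S\<close> indexed by the sets \<open>S \<subseteq> {..<m}\<close>, and a word of the
  language whose first half shows \<open>e S\<close> at the positions of class \<open>i\<close> exactly if \<open>i \<in> S\<close> and whose
  second half does so exactly if \<open>i \<notin> S\<close>. Between the halves, two of the \<open>2 ^ m\<close> data lie in the
  same registers, so they may be exchanged in the second half; then one of them occurs twice in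
  some class.

  The complement is covered by De Morgan's law.\<close>

subsection \<open>Runs\<close>

lemma run_Nil_iff [simp]: "run A c [] c' \<longleftrightarrow> c' = c"
  by (subst run.simps) auto

lemma run_Cons_iff: "run A c (x # w) c' \<longleftrightarrow> (\<exists>c''. step A c x c'' \<and> run A c'' w c')"
  by (subst run.simps) blast

lemma run_append_iff:
  "run A c (u @ v) c' \<longleftrightarrow> (\<exists>c''. run A c u c'' \<and> run A c'' v c')"
proof (induction u arbitrary: c)
  case Nil
  show ?case by simp
next
  case (Cons x u)
  then show ?case unfolding append_Cons run_Cons_iff by blast
qed

text \<open>Names the new valuation from the rule of \<open>step\<close>, so that updates can be
  computed apart from guards and states.\<close>

definition update_valuation ::
  "'r set \<Rightarrow> ('r \<Rightarrow> 'r source set) \<Rightarrow> ('r \<Rightarrow> 'd set) \<Rightarrow> 'd \<Rightarrow> 'r \<Rightarrow> 'd set" where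
  "update_valuation R up f d =
     (\<lambda>r\<in>R. (\<Union>r' \<in> {r' \<in> R. Reg r' \<in> up r}. f r') \<union> (if In \<in> up r then {d} else {}))"

lemma step_iff:
  "step A (q, f) (a, d) (s, f') \<longleftrightarrow>
    (\<exists>Gin Gout up. (q, a, Gin, Gout, up, s) \<in> transitions A \<and>
      (\<forall>r\<in>Gin. d \<in> f r) \<and> (\<forall>r\<in>Gout. d \<notin> f r) \<and>
      f' = update_valuation (registers A) up f d)"
  unfolding update_valuation_def by (subst step.simps) auto

lemma stepI:
  assumes "(q, a, Gin, Gout, up, s) \<in> transitions A" "\<forall>r\<in>Gin. d \<in> f r" "\<forall>r\<in>Gout. d \<notin> f r"
    "f' = update_valuation (registers A) up f d"
  shows "step A (q, f) (a, d) (s, f')"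
  using assms unfolding update_valuation_def by (rule step.intros)

lemma wf_rsa_iff:
  "wf_rsa A \<longleftrightarrow>
     finite (states A) \<and> finite (registers A) \<and> initial A \<subseteq> states A \<and> final A \<subseteq> states A \<and>
     (\<forall>q a Gin Gout up s. (q, a, Gin, Gout, up, s) \<in> transitions A \<longrightarrow>
        q \<in> states A \<and> s \<in> states A \<and> Gin \<subseteq> registers A \<and> Gout \<subseteq> registers A \<and> Gin \<inter> Gout = {} \<and>
        up \<in> registers A \<rightarrow>\<^sub>E Pow (insert In (Reg ` registers A)))"
  unfolding wf_rsa_def Ball_def split_paired_All prod.case by (rule refl)

lemma wf_rsaD:
  assumes "wf_rsa A" "(q, a, Gin, Gout, up, s) \<in> transitions A"
  shows "q \<in> states A" "s \<in> states A" "Gin \<subseteq> registers A" "Gout \<subseteq> registers A"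
    "Gin \<inter> Gout = {}" "up \<in> registers A \<rightarrow>\<^sub>E Pow (insert In (Reg ` registers A))"
  using assms unfolding wf_rsa_iff by simp_all

lemma step_states:
  assumes "wf_rsa A" "step A c x c'"
  shows "fst c \<in> states A" "fst c' \<in> states A"
  using assms(2) by (cases; simp add: wf_rsaD(1,2)[OF assms(1)])+

lemma rsa_language_eqI:
  assumes "\<And>w. (\<exists>c c'. initial_config A c \<and> run A c w c' \<and> fst c' \<in> final A) \<longleftrightarrow> w \<in> L"
  shows "rsa_language A = L"
  using assms unfolding rsa_language_def by blast

subsection \<open>Renaming states and registers\<close>

text \<open>The element type \<open>'x\<close> is left open because the same transport serves
  valuations (sets of data) and updates (sets of sources). Registers of \<open>R'\<close> outside
  the image of \<open>h\<close> get the empty set.\<close>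

definition rename_valuation :: "('r \<Rightarrow> 'r2) \<Rightarrow> 'r set \<Rightarrow> 'r2 set \<Rightarrow> ('r \<Rightarrow> 'x set) \<Rightarrow> 'r2 \<Rightarrow> 'x set" where
  "rename_valuation h R R' f = (\<lambda>r'\<in>R'. if r' \<in> h ` R then f (inv_into R h r') else {})"

text \<open>The set \<open>R'\<close> may exceed the image of \<open>h\<close>; such padding lets
  two automata be given the same register set.\<close>

definition rename_rsa ::
  "('q \<Rightarrow> 'q2) \<Rightarrow> ('r \<Rightarrow> 'r2) \<Rightarrow> 'r2 set \<Rightarrow> ('q, 'r, 'a) rsa \<Rightarrow> ('q2, 'r2, 'a) rsa" where
  "rename_rsa g h R' A =
     \<lparr>states = g ` states A, registers = R',
      transitions = (\<lambda>(q, a, Gin, Gout, up, s).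
        (g q, a, h ` Gin, h ` Gout,
         rename_valuation h (registers A) R' (\<lambda>r. map_source h ` up r), g s)) ` transitions A,
      initial = g ` initial A, final = g ` final A\<rparr>"

locale renaming =
  fixes g :: "'q \<Rightarrow> 'q2" and h :: "'r \<Rightarrow> 'r2" and R' :: "'r2 set" and A :: "('q, 'r, 'a) rsa"
  assumes wf: "wf_rsa A"
    and inj_g: "inj_on g (states A)"
    and inj_h: "inj_on h (registers A)"
    and h_into: "h ` registers A \<subseteq> R'"
    and fin: "finite R'"
begin

abbreviation "B \<equiv> rename_rsa g h R' A"
abbreviation "rv \<equiv> rename_valuation h (registers A) R'"

lemma rv_apply: "r \<in> registers A \<Longrightarrow> rv f (h r) = f r"
  using h_into inj_h by (auto simp: rename_valuation_def)

lemma update_rename_into: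
  assumes up: "up \<in> registers A \<rightarrow>\<^sub>E Pow (insert In (Reg ` registers A))"
  shows "rv (\<lambda>r. map_source h ` up r) \<in> R' \<rightarrow>\<^sub>E Pow (insert In (Reg ` R'))"
proof
  fix r' assume r': "r' \<in> R'"
  have "map_source h ` up r \<subseteq> insert In (Reg ` R')" if "r \<in> registers A" for r
  proof -
    have "map_source h ` up r \<subseteq> map_source h ` insert In (Reg ` registers A)"
      using PiE_mem[OF up that] by (intro image_mono) simp
    also have "\<dots> \<subseteq> insert In (Reg ` R')"
      using h_into by (auto simp: image_image)
    finally show ?thesis .
  qed
  with r' show "rv (\<lambda>r. map_source h ` up r) r' \<in> Pow (insert In (Reg ` R'))"
    by (simp add: rename_valuation_def inv_into_into del: Pow_insert)
qed (simp add: rename_valuation_def)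

lemma wf_rename: "wf_rsa B"
  unfolding wf_rsa_iff
proof (intro conjI[of "finite _"] conjI[of "_ \<subseteq> _"] allI impI)
  show "finite (states B)" "finite (registers B)" "initial B \<subseteq> states B" "final B \<subseteq> states B"
    using wf fin by (auto simp: wf_rsa_def rename_rsa_def)
next
  fix q' a Gin' Gout' up' s'
  assume "(q', a, Gin', Gout', up', s') \<in> transitions B"
  then obtain q Gin Gout up s where t: "(q, a, Gin, Gout, up, s) \<in> transitions A"
    and eq: "q' = g q" "Gin' = h ` Gin" "Gout' = h ` Gout" "s' = g s"
      "up' = rv (\<lambda>r. map_source h ` up r)"
    by (auto simp: rename_rsa_def)
  note w = wf_rsaD[OF wf t]
  have "h ` Gin \<inter> h ` Gout = {}"
    using w(3-5) inj_h by (metis image_empty inj_on_image_Int)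
  moreover have "h ` Gin \<subseteq> R'" "h ` Gout \<subseteq> R'" using w(3,4) h_into by blast+
  ultimately show "q' \<in> states B \<and> s' \<in> states B \<and> Gin' \<subseteq> registers B \<and> Gout' \<subseteq> registers B \<and>
      Gin' \<inter> Gout' = {} \<and> up' \<in> registers B \<rightarrow>\<^sub>E Pow (insert In (Reg ` registers B))"
    using w(1,2) update_rename_into[OF w(6)] unfolding eq by (simp add: rename_rsa_def)
qed

text \<open>A register outside the image of \<open>h\<close> has no sources, so it stays empty. The
  register sources of \<open>h r\<close> are the images of those of \<open>r\<close>, where the
  transported valuation has the same contents.\<close>

lemma update_rename:
  fixes d :: 'd
  assumes up: "up \<in> registers A \<rightarrow>\<^sub>E Pow (insert In (Reg ` registers A))"
  defines "up' \<equiv> rv (\<lambda>r. map_source h ` up r)"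
  shows "update_valuation R' up' (rv f) d = rv (update_valuation (registers A) up f d)"
  unfolding update_valuation_def
proof
  fix r'
  consider "r' \<notin> R'" | "r' \<in> R'" "r' \<notin> h ` registers A"
    | r where "r \<in> registers A" "r' = h r" by blast
  then show "(\<lambda>r\<in>R'. (\<Union>r' \<in> {r' \<in> R'. Reg r' \<in> up' r}. rv f r') \<union> (if In \<in> up' r then {d} else {})) r'
    = rv (\<lambda>r\<in>registers A. (\<Union>r' \<in> {r' \<in> registers A. Reg r' \<in> up r}. f r')
        \<union> (if In \<in> up r then {d} else {})) r'"
  proof cases
    case 1
    then show ?thesis by (simp add: rename_valuation_def)
  next
    case 2
    then show ?thesis by (simp add: rename_valuation_def up'_def)
  next
    case 3
    have up'r: "up' r' = map_source h ` up r"
      using 3 by (simp add: up'_def rv_apply)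
    have upr: "up r \<subseteq> insert In (Reg ` registers A)"
      using up 3 by (auto simp: PiE_iff)
    have In: "In \<in> map_source h ` up r \<longleftrightarrow> In \<in> up r"
      by (metis imageE image_eqI source.simps(8) source.distinct(1) source.exhaust source.simps(9))
    have "{y \<in> R'. Reg y \<in> map_source h ` up r} = h ` {y \<in> registers A. Reg y \<in> up r}"
    proof
      show "h ` {y \<in> registers A. Reg y \<in> up r} \<subseteq> {y \<in> R'. Reg y \<in> map_source h ` up r}"
        using h_into by force
      show "{y \<in> R'. Reg y \<in> map_source h ` up r} \<subseteq> h ` {y \<in> registers A. Reg y \<in> up r}"
        using upr by (fastforce)
    qed
    then have "(\<Union>y \<in> {y \<in> R'. Reg y \<in> up' r'}. rv f y) = (\<Union>y \<in> {y \<in> registers A. Reg y \<in> up r}. f y)"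
      by (simp add: up'r rv_apply)
    then show ?thesis
      using 3 h_into by (auto simp: up'r[unfolded 3] In rv_apply)
  qed
qed

text \<open>By injectivity of \<open>g\<close>, a transition leaving \<open>g q\<close> comes from
  one leaving \<open>q\<close>, and its guards read the same sets. The target is again a renamed
  configuration, so the equivalence can be iterated along runs.\<close>

lemma step_rename:
  fixes d :: 'd
  assumes q: "q \<in> states A"
  shows "step B (g q, rv f) (a, d) c2 \<longleftrightarrow>
    (\<exists>s f'. step A (q, f) (a, d) (s, f') \<and> c2 = (g s, rv f'))"
proof
  assume step: "step B (g q, rv f) (a, d) c2"
  obtain s2 f2 where c2: "c2 = (s2, f2)" by (cases c2)
  have reg: "registers B = R'" by (simp add: rename_rsa_def)
  obtain Gin2 Gout2 up2 where t2: "(g q, a, Gin2, Gout2, up2, s2) \<in> transitions B"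
    and g2: "\<forall>r\<in>Gin2. d \<in> rv f r" "\<forall>r\<in>Gout2. d \<notin> rv f r"
    and f2: "f2 = update_valuation R' up2 (rv f) d"
    using step unfolding c2 step_iff reg by (elim exE conjE)
  from t2 obtain p Gin Gout up s where
    t: "(p, a, Gin, Gout, up, s) \<in> transitions A" and p: "g p = g q"
    and eq: "Gin2 = h ` Gin" "Gout2 = h ` Gout" "s2 = g s" "up2 = rv (\<lambda>r. map_source h ` up r)"
    by (auto simp: rename_rsa_def)
  note w = wf_rsaD[OF wf t]
  have "p = q" using p w(1) q inj_g by (auto dest: inj_onD)
  moreover have "\<forall>r\<in>Gin. d \<in> f r" "\<forall>r\<in>Gout. d \<notin> f r"
    using g2 w(3,4) unfolding eq by (simp_all add: rv_apply subset_iff)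
  ultimately have "step A (q, f) (a, d) (s, update_valuation (registers A) up f d)"
    using t by (auto intro: stepI)
  moreover have "c2 = (g s, rv (update_valuation (registers A) up f d))"
    unfolding c2 f2 eq update_rename[OF w(6)] by simp
  ultimately show "\<exists>s f'. step A (q, f) (a, d) (s, f') \<and> c2 = (g s, rv f')" by blast
next
  assume "\<exists>s f'. step A (q, f) (a, d) (s, f') \<and> c2 = (g s, rv f')"
  then obtain s f' Gin Gout up where
    t: "(q, a, Gin, Gout, up, s) \<in> transitions A"
    and gi: "\<forall>r\<in>Gin. d \<in> f r" and go: "\<forall>r\<in>Gout. d \<notin> f r"
    and f': "f' = update_valuation (registers A) up f d"
    and c2: "c2 = (g s, rv f')"
    unfolding step_iff by (elim exE conjE)
  note w = wf_rsaD[OF wf t]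
  have "(g q, a, h ` Gin, h ` Gout, rv (\<lambda>r. map_source h ` up r), g s) \<in> transitions B"
    unfolding rename_rsa_def by (simp, rule image_eqI[OF _ t]) simp
  moreover have "\<forall>r\<in>h ` Gin. d \<in> rv f r" "\<forall>r\<in>h ` Gout. d \<notin> rv f r"
    using gi go w(3,4) by (simp_all add: rv_apply subset_iff)
  moreover have "rv f' = update_valuation (registers B) (rv (\<lambda>r. map_source h ` up r)) (rv f) d"
    unfolding f' update_rename[OF w(6), symmetric] by (simp add: rename_rsa_def)
  ultimately show "step B (g q, rv f) (a, d) c2"
    unfolding c2 by (rule stepI)
qed

lemma run_rename:
  fixes w :: "('a \<times> 'd) list"
  assumes "q \<in> states A"
  shows "run B (g q, rv f) w c2 \<longleftrightarrow> (\<exists>s f'. run A (q, f) w (s, f') \<and> c2 = (g s, rv f'))"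
  using assms
proof (induction w arbitrary: q f)
  case Nil
  show ?case by simp
next
  case (Cons x w)
  obtain a d where x: "x = (a, d)" by (cases x)
  have "run B (g q, rv f) (x # w) c2 \<longleftrightarrow>
      (\<exists>s f'. step A (q, f) x (s, f') \<and> run B (g s, rv f') w c2)"
    unfolding run_Cons_iff x step_rename[OF Cons.prems] by blast
  also have "\<dots> \<longleftrightarrow> (\<exists>s f'. step A (q, f) x (s, f') \<and>
      (\<exists>t f''. run A (s, f') w (t, f'') \<and> c2 = (g t, rv f'')))"
    using Cons.IH step_states(2)[OF wf] by (metis fst_conv)
  also have "\<dots> \<longleftrightarrow> (\<exists>t f''. run A (q, f) (x # w) (t, f'') \<and> c2 = (g t, rv f''))"
    unfolding run_Cons_iff split_paired_Ex by blast
  finally show ?case .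
qed

lemma run_states:
  assumes "run A c w c'" "fst c \<in> states A"
  shows "fst c' \<in> states A"
  using assms by induction (simp_all add: step_states(2)[OF wf])

lemma language_rename:
  "(rsa_language B :: ('a \<times> 'd) list set) = rsa_language A"
proof (rule rsa_language_eqI)
  fix w :: "('a \<times> 'd) list"
  have sub: "initial A \<subseteq> states A" "final A \<subseteq> states A"
    using wf by (auto simp: wf_rsa_def)
  define f0 :: "'r \<Rightarrow> 'd set" where "f0 = (\<lambda>r\<in>registers A. {})"
  \<comment> \<open>Padding registers hold the empty set, so the renamed initial valuation is the
    initial valuation of \<open>B\<close>.\<close>
  have f0: "(\<lambda>r\<in>registers B. {}) = rv f0"
    by (auto simp: rename_valuation_def f0_def rename_rsa_def inv_into_into fun_eq_iff)
  have run: "run B (g q, rv f0) w c' \<longleftrightarrow> (\<exists>s f'. run A (q, f0) w (s, f') \<and> c' = (g s, rv f'))"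
    if "q \<in> initial A" for q c'
    using sub(1) that by (intro run_rename) blast
  \<comment> \<open>The run ends in \<open>states A\<close>, where \<open>g\<close> is injective;
    hence finality is reflected by \<open>g\<close>.\<close>
  have final: "g s \<in> g ` final A \<longleftrightarrow> s \<in> final A"
    if "q \<in> initial A" "run A (q, f0) w (s, f')" for q s f'
    using inj_on_image_mem_iff[OF inj_g _ sub(2)] run_states[OF that(2)] that(1) sub(1) by auto
  have "(\<exists>c c'. initial_config B c \<and> run B c w c' \<and> fst c' \<in> final B) \<longleftrightarrow>
      (\<exists>q\<in>initial A. \<exists>c'. run B (g q, rv f0) w c' \<and> fst c' \<in> g ` final A)"
    unfolding initial_config_def f0 by (auto simp: rename_rsa_def)
  also have "\<dots> \<longleftrightarrow> (\<exists>q\<in>initial A. \<exists>s f'. run A (q, f0) w (s, f') \<and> g s \<in> g ` final A)"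
    by (intro bex_cong refl) (simp add: run, blast)
  also have "\<dots> \<longleftrightarrow> (\<exists>q\<in>initial A. \<exists>s f'. run A (q, f0) w (s, f') \<and> s \<in> final A)"
    by (intro bex_cong refl) (use final in blast)
  also have "\<dots> \<longleftrightarrow> w \<in> rsa_language A"
    by (auto simp: rsa_language_def initial_config_def f0_def)
  finally show "(\<exists>c c'. initial_config B c \<and> run B c w c' \<and> fst c' \<in> final B) \<longleftrightarrow>
      w \<in> rsa_language A" .
qed

end

subsection \<open>Union\<close>

text \<open>Intended for automata with the same registers, so that the updates of both are
  extensional on one set, and with disjoint states.\<close>

definition union_rsa :: "('q, 'r, 'a) rsa \<Rightarrow> ('q, 'r, 'a) rsa \<Rightarrow> ('q, 'r, 'a) rsa" where
  "union_rsa A B =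
     \<lparr>states = states A \<union> states B, registers = registers A,
      transitions = transitions A \<union> transitions B,
      initial = initial A \<union> initial B, final = final A \<union> final B\<rparr>"

lemma union_rsa_commute:
  "registers A = registers B \<Longrightarrow> union_rsa A B = union_rsa B A"
  by (simp add: union_rsa_def Un_commute)

lemma wf_union_rsa:
  assumes "wf_rsa A" "wf_rsa B" "registers A = registers B"
  shows "wf_rsa (union_rsa A B)"
  using assms unfolding wf_rsa_iff union_rsa_def
  by (simp del: Pow_insert) blast

text \<open>By disjointness, no transition of \<open>B\<close> leaves a state of
  \<open>A\<close>.\<close>

lemma step_union_rsa:
  assumes "wf_rsa B" "states A \<inter> states B = {}" "fst c \<in> states A"
  shows "step (union_rsa A B) c x c' \<longleftrightarrow> step A c x c'"
proof -
  obtain q f a d s f' where "c = (q, f)" "x = (a, d)" "c' = (s, f')"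
    by (metis surj_pair)
  moreover have "(q, a, Gin, Gout, up, s) \<notin> transitions B" if "q \<in> states A" for Gin Gout up
    using wf_rsaD(1)[OF assms(1)] assms(2) that by blast
  ultimately show ?thesis
    using assms(3) by (simp add: step_iff union_rsa_def)
qed

text \<open>A run started in \<open>A\<close> stays in \<open>A\<close>. The conjunct on
  \<open>fst c'\<close> serves to exclude the final states of \<open>B\<close> at its end.\<close>

lemma run_union_rsa:
  assumes "wf_rsa A" "wf_rsa B" "states A \<inter> states B = {}" "fst c \<in> states A"
  shows "run (union_rsa A B) c w c' \<longleftrightarrow> run A c w c' \<and> fst c' \<in> states A"
  using assms(4)
proof (induction w arbitrary: c)
  case (Cons x w)
  then show ?case
    unfolding run_Cons_iff step_union_rsa[OF assms(2,3) Cons.prems]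
    using step_states(2)[OF assms(1)] by blast
qed auto

lemma language_union_rsa:
  fixes A B :: "('q, 'r, 'a) rsa"
  assumes "wf_rsa A" "wf_rsa B" "registers A = registers B" "states A \<inter> states B = {}"
  shows "rsa_language (union_rsa A B) = rsa_language A \<union> rsa_language B"
proof (rule rsa_language_eqI)
  fix w :: "('a \<times> 'd) list"
  \<comment> \<open>Stated for fresh \<open>A\<close> and \<open>B\<close>, so that it applies again
    with the two roles exchanged.\<close>
  have *: "(\<exists>c c'. initial_config A c \<and> run (union_rsa A B) c w c' \<and> fst c' \<in> final A \<union> final B)
      \<longleftrightarrow> w \<in> rsa_language A"
    if "wf_rsa A" "wf_rsa B" "states A \<inter> states B = {}" for A B :: "('q, 'r, 'a) rsa"
  proof -
    have "initial A \<subseteq> states A" "final A \<subseteq> states A" "final B \<subseteq> states B"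
      using that by (auto simp: wf_rsa_def)
    then have "run (union_rsa A B) c w c' \<and> fst c' \<in> final A \<union> final B \<longleftrightarrow>
        run A c w c' \<and> fst c' \<in> final A" if "initial_config A c" for c c'
      using run_union_rsa[OF \<open>wf_rsa A\<close> \<open>wf_rsa B\<close> \<open>states A \<inter> states B = {}\<close>, of c w c'] that
        \<open>states A \<inter> states B = {}\<close>
      unfolding initial_config_def by blast
    then show ?thesis unfolding rsa_language_def by blast
  qed
  have "initial_config (union_rsa A B) c \<longleftrightarrow> initial_config A c \<or> initial_config B c"
    for c :: "('q, 'r, 'd) config"
    using assms(3) by (auto simp: initial_config_def union_rsa_def)
  moreover have "final (union_rsa A B) = final A \<union> final B" by (simp add: union_rsa_def)
  moreover have "w \<in> rsa_language B \<longleftrightarrow> (\<exists>c c'. initial_config B c \<and>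
      run (union_rsa A B) c w c' \<and> fst c' \<in> final A \<union> final B)"
    using *[OF assms(2,1)] assms(4)
    by (simp only: union_rsa_commute[OF assms(3)] Int_commute Un_commute)
  ultimately show "(\<exists>c c'. initial_config (union_rsa A B) c \<and> run (union_rsa A B) c w c' \<and>
      fst c' \<in> final (union_rsa A B)) \<longleftrightarrow> w \<in> rsa_language A \<union> rsa_language B"
    unfolding Un_iff[of w] *[OF assms(1,2,4), symmetric] by metis
qed

lemma rsa_languages_union:
  assumes "L1 \<in> rsa_languages n" "L2 \<in> rsa_languages n"
  shows "L1 \<union> L2 \<in> rsa_languages n"
proof -
  \<comment> \<open>Normal form: padding brings the registers to exactly \<open>{..<n}\<close>, and
    the injection \<open>g\<close> decides where the states lie.\<close>
  have norm: "\<exists>B :: (nat, nat, 'a) rsa. wf_rsa B \<and> registers B = {..<n} \<and>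
      states B \<subseteq> range g \<and> rsa_language B = L"
    if L: "L \<in> rsa_languages n" and g: "inj g"
    for L :: "('a \<times> 'b) list set" and g :: "nat \<Rightarrow> nat"
  proof -
    obtain A :: "(nat, nat, 'a) rsa"
      where A: "wf_rsa A" "card (registers A) \<le> n" "L = rsa_language A"
      using L unfolding rsa_languages_def by blast
    have "finite (registers A)" using A(1) by (simp add: wf_rsa_def)
    then obtain h where h: "h ` registers A \<subseteq> {..<n}" "inj_on h (registers A)"
      using A(2) card_le_inj[of "registers A" "{..<n}"] by auto
    interpret renaming g h "{..<n}" A
      by unfold_locales (use A h g in \<open>auto intro: inj_on_subset\<close>)
    have "wf_rsa B" "registers B = {..<n}" "states B \<subseteq> range g" "rsa_language B = L"
      using wf_rename language_rename A(3) by (auto simp: rename_rsa_def)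
    then show ?thesis by blast
  qed
  \<comment> \<open>The states of the first automaton become even and those of the second odd, hence
    disjoint.\<close>
  have "inj (\<lambda>q::nat. 2 * q)" "inj (\<lambda>q::nat. 2 * q + 1)" by (auto simp: inj_def)
  from norm[OF assms(1) this(1)] norm[OF assms(2) this(2)]
  obtain A B :: "(nat, nat, 'a) rsa" where
    A: "wf_rsa A" "registers A = {..<n}" "states A \<subseteq> range (\<lambda>q. 2 * q)" "rsa_language A = L1" and
    B: "wf_rsa B" "registers B = {..<n}" "states B \<subseteq> range (\<lambda>q. 2 * q + 1)" "rsa_language B = L2"
    by blast
  have "states A \<inter> states B = {}"
  proof -
    have "2 * x \<noteq> 2 * y + 1" for x y :: nat by presburger
    with A(3) B(3) show ?thesis by blast
  qed
  then have "rsa_language (union_rsa A B) = L1 \<union> L2" "wf_rsa (union_rsa A B)"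
    using A B language_union_rsa wf_union_rsa by metis+
  moreover have "card (registers (union_rsa A B)) \<le> n"
    using A by (simp add: union_rsa_def)
  ultimately show ?thesis unfolding rsa_languages_def by blast
qed

subsection \<open>Distinct data in residue classes of positions\<close>

text \<open>Positions count from 0. The set \<open>I\<close> of constrained classes is a parameter,
  so that both intersected languages and their intersection are instances.\<close>

definition distinct_classes :: "nat \<Rightarrow> nat set \<Rightarrow> ('a \<times> 'd) list set" where
  "distinct_classes m I =
     {w. \<forall>k<length w. \<forall>j<k. j mod m = k mod m \<and> k mod m \<in> I \<longrightarrow> snd (w ! j) \<noteq> snd (w ! k)}"

definition class_update :: "nat set \<Rightarrow> nat \<Rightarrow> nat \<Rightarrow> nat source set" where
  "class_update I q = (\<lambda>r\<in>I. if r = q then {In, Reg r} else {Reg r})"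

text \<open>The state is the current position modulo \<open>m\<close>, and register \<open>r\<close>
  collects the data seen in class \<open>r\<close>. The negative guard \<open>I \<inter> {q}\<close>
  is empty for an unconstrained class. A repetition blocks the run, so every state can be
  final.\<close>

definition class_rsa :: "nat \<Rightarrow> nat set \<Rightarrow> (nat, nat, 'a) rsa" where
  "class_rsa m I =
     \<lparr>states = {..<m}, registers = I,
      transitions = {(q, a, {}, I \<inter> {q}, class_update I q, Suc q mod m) | q a. q < m},
      initial = {0}, final = {..<m}\<rparr>"

text \<open>The register contents of \<open>class_rsa\<close> after reading \<open>w\<close>; this
  is the invariant of its runs.\<close>

definition class_data :: "nat \<Rightarrow> nat set \<Rightarrow> ('a \<times> 'd) list \<Rightarrow> nat \<Rightarrow> 'd set" where
  "class_data m I w = (\<lambda>r\<in>I. {snd (w ! j) | j. j < length w \<and> j mod m = r})"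

lemma wf_class_rsa:
  assumes "m > 0" "finite I"
  shows "wf_rsa (class_rsa m I)"
  using assms by (auto simp: wf_rsa_def class_rsa_def class_update_def)

text \<open>Appending a letter adds only the pairs that end in the last position, and these are what
  the guard tests.\<close>

lemma distinct_classes_snoc:
  "w @ [x] \<in> distinct_classes m I \<longleftrightarrow> w \<in> distinct_classes m I \<and>
    (length w mod m \<in> I \<longrightarrow> snd x \<notin> class_data m I w (length w mod m))"
proof -
  have "w @ [x] \<in> distinct_classes m I \<longleftrightarrow> w \<in> distinct_classes m I \<and>
    (\<forall>j<length w. j mod m = length w mod m \<and> length w mod m \<in> I \<longrightarrow> snd (w ! j) \<noteq> snd x)"
    unfolding distinct_classes_def
    by (auto simp: nth_append less_Suc_eq all_conj_distrib)
  then show ?thesis by (auto simp: class_data_def)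
qed

lemma class_data_snoc:
  "class_data m I (w @ [x]) = (\<lambda>r\<in>I. class_data m I w r \<union> (if length w mod m = r then {snd x} else {}))"
proof
  fix r
  have "{j. j < Suc (length w) \<and> j mod m = r} =
    {j. j < length w \<and> j mod m = r} \<union> (if length w mod m = r then {length w} else {})"
    by (auto simp: less_Suc_eq)
  moreover have "(\<lambda>j. snd ((w @ [x]) ! j)) ` {j. j < length w \<and> j mod m = r} =
    (\<lambda>j. snd (w ! j)) ` {j. j < length w \<and> j mod m = r}"
    by (intro image_cong refl) (simp add: nth_append)
  ultimately have "(\<lambda>j. snd ((w @ [x]) ! j)) ` {j. j < Suc (length w) \<and> j mod m = r} =
    (\<lambda>j. snd (w ! j)) ` {j. j < length w \<and> j mod m = r} \<union>
      (if length w mod m = r then {snd x} else {})"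
    by (simp add: image_Un)
  then show "class_data m I (w @ [x]) r =
    (\<lambda>r\<in>I. class_data m I w r \<union> (if length w mod m = r then {snd x} else {})) r"
    by (simp add: class_data_def setcompr_eq_image)
qed

lemma step_class_rsa:
  "step (class_rsa m I) (q, f) (a, d) c' \<longleftrightarrow>
    q < m \<and> (q \<in> I \<longrightarrow> d \<notin> f q) \<and>
    c' = (Suc q mod m, \<lambda>r\<in>I. f r \<union> (if q = r then {d} else {}))"
proof -
  have "update_valuation I (class_update I q) f d = (\<lambda>r\<in>I. f r \<union> (if q = r then {d} else {}))"
    by (auto simp: update_valuation_def class_update_def fun_eq_iff)
  then show ?thesis
    by (cases c') (auto simp: step_iff class_rsa_def)
qed

text \<open>The automaton is deterministic up to blocking. Induction from the right fits, since
  state and registers describe the prefix already read.\<close>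

lemma run_class_rsa:
  assumes "m > 0"
  shows "run (class_rsa m I) (0, \<lambda>r\<in>I. {}) w c \<longleftrightarrow>
    w \<in> distinct_classes m I \<and> c = (length w mod m, class_data m I w)"
proof (induction w arbitrary: c rule: rev_induct)
  case Nil
  show ?case by (simp add: distinct_classes_def class_data_def)
next
  case (snoc x w)
  obtain a d where x: "x = (a, d)" by (cases x)
  show ?case
    unfolding run_append_iff run_Cons_iff run_Nil_iff snoc.IH x distinct_classes_snoc class_data_snoc snd_conv
    using assms by (auto simp: step_class_rsa mod_Suc_eq simp del: restrict_apply)
qed

lemma language_class_rsa:
  assumes "m > 0"
  shows "rsa_language (class_rsa m I) = distinct_classes m I"
proof (rule rsa_language_eqI)
  fix w :: "('a \<times> 'd) list"
  have "initial_config (class_rsa m I) c \<longleftrightarrow> c = (0, \<lambda>r\<in>I. {})" for c :: "(nat, nat, 'd) config"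
    by (cases c) (auto simp: initial_config_def class_rsa_def)
  moreover have final: "final (class_rsa m I) = {..<m}" by (simp add: class_rsa_def)
  ultimately show "(\<exists>c c'. initial_config (class_rsa m I) c \<and> run (class_rsa m I) c w c' \<and>
      fst c' \<in> final (class_rsa m I)) \<longleftrightarrow> w \<in> distinct_classes m I"
    using assms run_class_rsa[OF assms, of I w] final
    by (metis fst_conv lessThan_iff mod_less_divisor)
qed

lemma distinct_classes_in_rsa_languages:
  assumes "m > 0" "finite I" "card I \<le> n"
  shows "distinct_classes m I \<in> rsa_languages n"
  unfolding rsa_languages_def mem_Collect_eq
  by (rule exI[of _ "class_rsa m I"])
    (use assms in \<open>simp add: language_class_rsa wf_class_rsa\<close>, simp add: class_rsa_def)

subsection \<open>Permuting data values\<close>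

definition map_config :: "('q, 'r, 'a) rsa \<Rightarrow> ('d \<Rightarrow> 'd) \<Rightarrow> ('q, 'r, 'd) config \<Rightarrow> ('q, 'r, 'd) config" where
  "map_config A \<pi> c = (fst c, \<lambda>r\<in>registers A. \<pi> ` snd c r)"

text \<open>Transitions mention no data and guards only test membership, so steps are equivariant.
  Injectivity of \<open>\<pi>\<close> preserves the negative guards.\<close>

lemma step_map_config:
  assumes wf: "wf_rsa A" and "inj \<pi>" and "step A c x c'"
  shows "step A (map_config A \<pi> c) (map_prod id \<pi> x) (map_config A \<pi> c')"
  using assms(3)
proof cases
  case (1 q a Gin Gout up s d f f')
  note w = wf_rsaD[OF wf 1(4)]
  have "\<forall>r\<in>Gin. \<pi> d \<in> (\<lambda>r\<in>registers A. \<pi> ` f r) r"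
    using 1 w by auto
  moreover have "\<forall>r\<in>Gout. \<pi> d \<notin> (\<lambda>r\<in>registers A. \<pi> ` f r) r"
    using 1 w \<open>inj \<pi>\<close> by (auto simp: inj_image_mem_iff subset_iff)
  moreover have "(\<lambda>r\<in>registers A. \<pi> ` f' r) =
      update_valuation (registers A) up (\<lambda>r\<in>registers A. \<pi> ` f r) (\<pi> d)"
    unfolding 1 update_valuation_def by (auto simp: fun_eq_iff image_Un image_UN)
  ultimately show ?thesis
    using 1(4) unfolding 1(1-3) map_config_def by (auto intro: stepI simp del: restrict_apply)
qed

lemma run_map_config:
  assumes "wf_rsa A" "inj \<pi>" "run A c w c'"
  shows "run A (map_config A \<pi> c) (map (map_prod id \<pi>) w) (map_config A \<pi> c')"
  using assms(3)
proof induction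
  case (run_Cons c x c' w c'')
  then show ?case
    unfolding list.map run_Cons_iff using step_map_config[OF assms(1,2)] by blast
qed simp

section \<open>Lower bound: \<open>n\<close> registers cannot handle \<open>n + 1\<close> residue
  classes\<close>

lemma run_extensional:
  assumes "run A c w c'" "snd c \<in> extensional (registers A)"
  shows "snd c' \<in> extensional (registers A)"
  using assms by induction (auto elim: step.cases)

text \<open>Exactly half of the subsets of \<open>{..<Suc n}\<close> contain \<open>i\<close>; list
  these first and the others after them. This gives the order in which class \<open>i\<close> will
  show its data.\<close>

lemma subset_enumeration:
  assumes "i < Suc n"
  obtains \<gamma> where "bij_betw \<gamma> {..<2 * 2 ^ n :: nat} (Pow {..<Suc n})"
    "\<And>t. t < 2 * 2 ^ n \<Longrightarrow> i \<in> \<gamma> t \<longleftrightarrow> t < 2 ^ n"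
proof -
  let ?P = "Pow {..<Suc n}" and ?N = "Pow ({..<Suc n} - {i})"
  have N: "card ?N = 2 ^ n" using assms by (simp add: card_Pow)
  have "card (?P - ?N) = card ?P - card ?N" by (rule card_Diff_subset) auto
  also have "\<dots> = 2 ^ n" unfolding N by (simp add: card_Pow)
  finally have Y: "card (?P - ?N) = 2 ^ n" .
  obtain f :: "nat \<Rightarrow> nat set" where f: "bij_betw f {..<2 ^ n} (?P - ?N)"
    using Y finite_same_card_bij[of "{..<2 ^ n :: nat}" "?P - ?N"] by auto
  obtain g :: "nat \<Rightarrow> nat set" where g: "bij_betw g {2 ^ n..<2 * 2 ^ n} ?N"
    using N finite_same_card_bij[of "{2 ^ n..<2 * 2 ^ n :: nat}" ?N] by auto
  define \<gamma> where "\<gamma> t = (if t < 2 ^ n then f t else g t)" for t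
  have f': "bij_betw \<gamma> {..<2 ^ n} (?P - ?N)"
    using f by (rule bij_betw_cong[THEN iffD1, rotated]) (simp add: \<gamma>_def)
  have g': "bij_betw \<gamma> {2 ^ n..<2 * 2 ^ n} ?N"
    using g by (rule bij_betw_cong[THEN iffD1, rotated]) (simp add: \<gamma>_def)
  have "{..<2 * 2 ^ n :: nat} = {..<2 ^ n} \<union> {2 ^ n..<2 * 2 ^ n}" by auto
  moreover have "?P = (?P - ?N) \<union> ?N" by auto
  ultimately have "bij_betw \<gamma> {..<2 * 2 ^ n} ?P"
    using bij_betw_combine[OF f' g'] by (metis Diff_disjoint Int_commute)
  moreover have "i \<in> \<gamma> t \<longleftrightarrow> t < 2 ^ n" if "t < 2 * 2 ^ n" for t
  proof (cases "t < 2 ^ n")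
    case True
    then have "\<gamma> t \<in> ?P - ?N" using f' by (auto dest: bij_betwE)
    with True show ?thesis by auto
  next
    case False
    then have "\<gamma> t \<in> ?N" using bij_betw_apply[OF g'] that by simp
    with False show ?thesis by auto
  qed
  ultimately show ?thesis by (rule that)
qed

lemma distinct_classes_notin_rsa_languages:
  assumes inf: "infinite (UNIV :: 'd set)"
  shows "(distinct_classes (Suc n) {..<Suc n} :: ('a \<times> 'd) list set) \<notin> rsa_languages n"
proof
  let ?m = "Suc n" and ?K = "2 ^ n :: nat"
  let ?L = "distinct_classes ?m {..<?m} :: ('a \<times> 'd) list set"
  assume "?L \<in> rsa_languages n"
  then obtain A :: "(nat, nat, 'a) rsa" where
    A: "wf_rsa A" "card (registers A) \<le> n" "rsa_language A = ?L"
    unfolding rsa_languages_def by auto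
  have "\<forall>i. \<exists>\<gamma>. i < ?m \<longrightarrow> bij_betw \<gamma> {..<2 * ?K} (Pow {..<?m}) \<and>
      (\<forall>t<2 * ?K. i \<in> \<gamma> t \<longleftrightarrow> t < ?K)"
    by (metis subset_enumeration)
  then obtain \<gamma> where
    bij: "\<And>i. i < ?m \<Longrightarrow> bij_betw (\<gamma> i) {..<2 * ?K} (Pow {..<?m})" and
    half: "\<And>i t. i < ?m \<Longrightarrow> t < 2 * ?K \<Longrightarrow> i \<in> \<gamma> i t \<longleftrightarrow> t < ?K"
    by metis
  \<comment> \<open>Infinity of the data domain provides a distinct datum \<open>e S\<close> for
    each subset \<open>S\<close>.\<close>
  obtain D :: "'d set" where D: "finite D" "card D = card (Pow {..<?m})"
    using infinite_arbitrarily_large[OF inf] by blast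
  obtain e :: "nat set \<Rightarrow> 'd" where e: "inj_on e (Pow {..<?m})"
    using finite_same_card_bij[OF _ D(1) D(2)[symmetric]] by (auto simp: bij_betw_def)
  \<comment> \<open>Position \<open>p\<close> belongs to class \<open>p mod ?m\<close> and round
    \<open>p div ?m\<close>; in round \<open>t\<close>, class \<open>i\<close> shows
    \<open>e (\<gamma> i t)\<close>. The alphabet component is an arbitrary constant, as the
    language constrains data only. The cut between \<open>u\<close> and \<open>v\<close> comes after
    \<open>?K\<close> of the \<open>2 * ?K\<close> rounds.\<close>
  define letter :: "nat \<Rightarrow> 'a \<times> 'd"
    where "letter p = (undefined, e (\<gamma> (p mod ?m) (p div ?m)))" for p
  define u where "u = map letter [0..<?K * ?m]"
  define v where "v = map letter [?K * ?m..<2 * ?K * ?m]"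
  have uv: "u @ v = map letter [0..<2 * ?K * ?m]"
    unfolding u_def v_def map_append[symmetric]
    using upt_add_eq_append[of 0 "?K * ?m" "?K * ?m"]
    by (simp only: mult_2 distrib_right le0)
  \<comment> \<open>Distinct positions of one class lie in distinct rounds, and both
    \<open>\<gamma> i\<close> and \<open>e\<close> are injective.\<close>
  have "u @ v \<in> ?L"
    unfolding distinct_classes_def uv
  proof (intro CollectI allI impI)
    fix k j
    assume "k < length (map letter [0..<2 * ?K * ?m])" and "j < k"
      and mod: "j mod ?m = k mod ?m \<and> k mod ?m \<in> {..<?m}"
    then have k: "k < 2 * ?K * ?m" and j: "j < 2 * ?K * ?m" by auto
    have dv: "k div ?m < 2 * ?K" "j div ?m < 2 * ?K"
      using k j by (auto simp only: less_mult_imp_div_less)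
    have "j div ?m \<noteq> k div ?m" using \<open>j < k\<close> mod by (metis div_mult_mod_eq less_irrefl)
    then have "\<gamma> (k mod ?m) (j div ?m) \<noteq> \<gamma> (k mod ?m) (k div ?m)"
      using bij[of "k mod ?m"] dv by (auto simp: bij_betw_def inj_on_def)
    moreover have "\<gamma> (k mod ?m) t \<in> Pow {..<?m}" if "t < 2 * ?K" for t
      using bij[of "k mod ?m"] that by (auto dest: bij_betwE)
    ultimately have "e (\<gamma> (k mod ?m) (j div ?m)) \<noteq> e (\<gamma> (k mod ?m) (k div ?m))"
      using e dv by (meson inj_onD)
    then show "snd (map letter [0..<2 * ?K * ?m] ! j) \<noteq> snd (map letter [0..<2 * ?K * ?m] ! k)"
      using k j mod by (simp add: letter_def del: mult_Suc_right)
  qed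
  then have "u @ v \<in> rsa_language A" by (simp only: A(3))
  then obtain c0 c' where c0: "initial_config A c0" and "run A c0 (u @ v) c'"
    and fin: "fst c' \<in> final A"
    unfolding rsa_language_def by blast
  then obtain c where ru: "run A c0 u c" and rv: "run A c v c'"
    unfolding run_append_iff by blast
  have ext: "snd c \<in> extensional (registers A)"
    using run_extensional[OF ru] c0 by (simp add: initial_config_def)
  \<comment> \<open>The set of registers holding \<open>e S\<close> at the cut: at most
    \<open>2 ^ n\<close> values for \<open>2 ^ Suc n\<close> sets \<open>S\<close>, so two sets
    share a value.\<close>
  define T where "T S = {r \<in> registers A. e S \<in> snd c r}" for S
  have "finite (registers A)" using A(1) by (simp add: wf_rsa_def)
  have "T ` Pow {..<?m} \<subseteq> Pow (registers A)" by (auto simp: T_def)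
  then have "card (T ` Pow {..<?m}) \<le> card (Pow (registers A))"
    using \<open>finite (registers A)\<close> by (intro card_mono) auto
  also have "\<dots> \<le> 2 ^ n"
    using \<open>finite (registers A)\<close> A(2) by (simp add: card_Pow)
  also have "\<dots> < card (Pow {..<?m})" by (simp add: card_Pow)
  finally have "\<not> inj_on T (Pow {..<?m})" by (rule pigeonhole)
  then obtain S0 S1 where S01: "S0 \<subseteq> {..<?m}" "S1 \<subseteq> {..<?m}" "S0 \<noteq> S1" "T S0 = T S1"
    by (auto simp: inj_on_def)
  \<comment> \<open>One of the two inclusions between \<open>S0\<close> and \<open>S1\<close> fails;
    name the sets so that \<open>i\<close> witnesses this.\<close>
  then obtain S S' i where S: "S \<subseteq> {..<?m}" "S' \<subseteq> {..<?m}" "i \<in> S" "i \<notin> S'" "T S = T S'"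
    by (metis subset_antisym subsetI)
  define \<pi> where "\<pi> = transpose (e S) (e S')"
  \<comment> \<open>Each register contains both exchanged data or neither, so \<open>c\<close> is
    fixed and the renamed second half can be read from it.\<close>
  have "\<pi> ` snd c r = snd c r" if "r \<in> registers A" for r
    unfolding \<pi>_def using S(5) that by (intro transpose_image_eq) (auto simp: T_def)
  then have "map_config A \<pi> c = c"
    using ext by (auto simp: map_config_def prod_eq_iff fun_eq_iff extensional_def)
  moreover have "inj \<pi>" by (simp add: \<pi>_def)
  ultimately have "run A c (map (map_prod id \<pi>) v) (map_config A \<pi> c')"
    using run_map_config[OF A(1) _ rv] by metis
  then have "run A c0 (u @ map (map_prod id \<pi>) v) (map_config A \<pi> c')"
    using ru unfolding run_append_iff by blast
  moreover have "fst (map_config A \<pi> c') \<in> final A" using fin by (simp add: map_config_def)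
  ultimately have "u @ map (map_prod id \<pi>) v \<in> rsa_language A"
    unfolding rsa_language_def using c0 by blast
  then have L: "u @ map (map_prod id \<pi>) v \<in> ?L" by (simp only: A(3))
  have i: "i < ?m" using S by auto
  have "S \<in> \<gamma> i ` {..<2 * ?K}" "S' \<in> \<gamma> i ` {..<2 * ?K}"
    using S(1,2) bij_betw_imp_surj_on[OF bij[OF i]] by blast+
  then obtain t t' where t: "t < 2 * ?K" "\<gamma> i t = S" and t': "t' < 2 * ?K" "\<gamma> i t' = S'"
    by blast
  \<comment> \<open>Since \<open>i \<in> S\<close> and \<open>i \<notin> S'\<close>, class
    \<open>i\<close> shows \<open>e S\<close> before the cut and \<open>e S'\<close> after it. The
    positions \<open>j\<close> and \<open>k\<close> are where this happens.\<close>
  have tK: "t < ?K" "\<not> t' < ?K" using half[OF i] t t' S by auto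
  define j k where "j = t * ?m + i" and "k = t' * ?m + i"
  have bound: "s * ?m + i < K * ?m" if "s < K" for s K
  proof -
    have "s * ?m + i < Suc s * ?m" using i by simp
    also have "\<dots> \<le> K * ?m" using that by (intro mult_le_mono1) simp
    finally show ?thesis .
  qed
  have j: "j < ?K * ?m" "j mod ?m = i" "j div ?m = t"
    using bound[OF tK(1)] i by (simp_all add: j_def del: mult_Suc_right)
  have "?K * ?m \<le> t' * ?m" using tK(2) by (intro mult_le_mono1) simp
  then have "?K * ?m \<le> k" unfolding k_def by (rule trans_le_add1)
  moreover have "k < 2 * ?K * ?m" unfolding k_def by (rule bound[OF t'(1)])
  moreover have "k mod ?m = i" "k div ?m = t'"
    using i by (simp_all add: k_def del: mult_Suc_right)
  ultimately have k: "?K * ?m \<le> k" "k < 2 * ?K * ?m" "k mod ?m = i" "k div ?m = t'" .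
  define w where "w = u @ map (map_prod id \<pi>) v"
  have len: "length u = ?K * ?m" "length v = 2 * ?K * ?m - ?K * ?m"
    by (simp_all only: u_def v_def length_map length_upt diff_zero)
  have "w ! j = letter j"
    using j(1) len(1) by (simp only: w_def nth_append u_def length_map if_True nth_map_upt diff_zero add_0)
  then have wj: "snd (w ! j) = e S" using j t by (simp add: letter_def)
  have kv: "k - ?K * ?m < length v" using k(1,2) len(2) by linarith
  have "w ! k = map_prod id \<pi> (v ! (k - ?K * ?m))"
    using k(1) kv len(1) unfolding w_def nth_append by (simp only: nth_map not_less[symmetric] if_False)
  also have "v ! (k - ?K * ?m) = letter k"
    using k(1,2) kv unfolding v_def by (subst nth_map_upt) (simp_all only: le_add_diff_inverse diff_less_mono)
  \<comment> \<open>The exchange turns \<open>e S'\<close> at position \<open>k\<close> into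
    \<open>e S\<close>, the datum already present at position \<open>j\<close> of the same
    class.\<close>
  finally have wk: "snd (w ! k) = e S" using k t' by (simp add: letter_def \<pi>_def)
  have "j < k" "k < length w"
    using j(1) k(1,2) len by (simp_all only: w_def length_append length_map)
  then show False
    using L[folded w_def, unfolded distinct_classes_def mem_Collect_eq, rule_format, of k j]
      j(2) k(3) i wj wk by simp
qed

section \<open>Closure properties for a fixed number of registers\<close>

theorem theorem4p4:
  fixes n :: nat
  assumes "infinite (UNIV :: 'd set)"
    and "n \<ge> 1"
  shows "(\<forall>L1 L2 :: ('a::finite \<times> 'd) list set.
            L1 \<in> rsa_languages n \<longrightarrow> L2 \<in> rsa_languages n \<longrightarrow> L1 \<union> L2 \<in> rsa_languages n)
       \<and> \<not> (\<forall>L1 L2 :: ('a \<times> 'd) list set.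
            L1 \<in> rsa_languages n \<longrightarrow> L2 \<in> rsa_languages n \<longrightarrow> L1 \<inter> L2 \<in> rsa_languages n)
       \<and> \<not> (\<forall>L :: ('a \<times> 'd) list set.
            L \<in> rsa_languages n \<longrightarrow> UNIV - L \<in> rsa_languages n)"
proof -
  let ?C = "\<lambda>I. distinct_classes (Suc n) I :: ('a \<times> 'd) list set"
  have un: "\<forall>L1 L2 :: ('a \<times> 'd) list set.
      L1 \<in> rsa_languages n \<longrightarrow> L2 \<in> rsa_languages n \<longrightarrow> L1 \<union> L2 \<in> rsa_languages n"
    by (blast intro: rsa_languages_union)
  \<comment> \<open>The class \<open>n\<close> alone takes one register, which is available because
    \<open>n \<ge> 1\<close>.\<close>
  have C: "?C {..<n} \<in> rsa_languages n" "?C {n} \<in> rsa_languages n"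
    using assms(2) by (auto intro: distinct_classes_in_rsa_languages)
  have "?C {..<n} \<inter> ?C {n} = ?C {..<Suc n}"
    unfolding distinct_classes_def lessThan_Suc by blast
  then have int: "?C {..<n} \<inter> ?C {n} \<notin> rsa_languages n"
    using distinct_classes_notin_rsa_languages[OF assms(1)] by metis
  have "\<not> (\<forall>L :: ('a \<times> 'd) list set. L \<in> rsa_languages n \<longrightarrow> UNIV - L \<in> rsa_languages n)"
  proof
    assume "\<forall>L :: ('a \<times> 'd) list set. L \<in> rsa_languages n \<longrightarrow> UNIV - L \<in> rsa_languages n"
    then have "UNIV - ((UNIV - ?C {..<n}) \<union> (UNIV - ?C {n})) \<in> rsa_languages n"
      using un C by blast
    moreover have "UNIV - ((UNIV - ?C {..<n}) \<union> (UNIV - ?C {n})) = ?C {..<n} \<inter> ?C {n}"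
      by blast
    ultimately show False using int by simp
  qed
  with un C int show ?thesis by blast
qed

end
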